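(* Let $0<\gamma<1$, $0\le\sigma\le 1$, let $\alpha,\beta$ be real numbers with $\alpha\beta>0$, and suppose that $$(\beta\alpha^{-1}-1)(\alpha^2-1)\ge 0 .$$ Let $y$ be a solution of the weighted difference scheme with $\varphi\equiv 0$ and $\mu\equiv 0$, that is, $$\Delta_{0t_{n+1}}^{\gamma} y_i-(ay_{\bar x}^{(\sigma)})_{x,i}=0,\qquad i=1,\dots,N-1,$$ $$y_0^{n+1}-\alpha y_N^{n+1}=0,\qquad \beta\,\Delta_{0t_{n+1}}^{\gamma}y_0+\Delta_{0t_{n+1}}^{\gamma}y_N+\frac{2}{h}\left(a_Ny_{\bar x,N}^{(\sigma)}-\beta a_1y_{x,0}^{(\sigma)}\right)=0,$$ for all $n=0,1,\dots,N_t-1$, with $y_i^0=u_0(x_i)$, $i=0,\dots,N$. Then the condition $$\sigma\ \ge\ \frac{1}{3-2^{1-\gamma}}-\frac{h^2(2-2^{1-\gamma})}{2c_2\tau^{\gamma}(3-2^{1-\gamma})\Gamma(2-\gamma)}$$ is sufficient for the stability of the scheme; namely, under this condition the solution satisfies $$\|y^{n+1}\|_1\le \|y^0\|_1,\qquad n=0,1,\dots,N_t-1,$$ where the norm $\|\cdot\|_1$ is defined as follows. If $\beta\alpha^{-1}-1\ge0$ and $\alpha^2-1\ge0$, then $$\|y\|_1^2=\|y\|_0^2+\delta_1\|p_1y\|_0^2+\frac{\alpha\beta+1}{2\alpha^2}\,y_0^2h,\qquad p_1^2(x_i)=\sum_{s=i}^{N-1}\frac{h}{a_{s+1}},\quad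 \delta_1=\frac{\beta\alpha^{-1}-1}{p_1^2(0)} .$$ If $\beta\alpha^{-1}-1\le0$ and $\alpha^2-1\le0$, then $$\|y\|_1^2=\|y\|_0^2+\tilde\delta_1\sum_{i=1}^{N-1}\tilde p_1^2(1-x_i)\,y_i^2h+\frac{\alpha^{-1}\beta^{-1}+1}{2\alpha^{-2}}\,\alpha^{-2}y_0^2h,\qquad \tilde p_1^2(x_i)=\sum_{s=i}^{N-1}\frac{h}{a_{N-s}},\quad \tilde\delta_1=\frac{\alpha\beta^{-1}-1}{\tilde p_1^2(0)} .$$ Moreover, on grid functions satisfying $y_0=\alpha y_N$, the norm $\|y\|_1$ is equivalent (with constants independent of $h$) to the norm $|[y]|_0$ given by $|[y]|_0^2=\tfrac12hy_0^2+\tfrac12hy_N^2+\|y\|_0^2$.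
   Context: Grids: $x_i=ih$, $i=0,\dots,N$, $h=1/N$; $t_n=n\tau$, $n=0,\dots,N_t$, $\tau=T/N_t$, $T>0$. Grid functions are written $y_i^n=y(x_i,t_n)$. The coefficient $k:[0,1]\to\mathbb R$ satisfies $0<c_1\le k(x)\le c_2$ for all $x\in[0,1]$, and $a_i=k(x_i-0.5h)$, $i=1,\dots,N$. Notation: $y_{\bar x,i}=(y_i-y_{i-1})/h$, $y_{x,i}=(y_{i+1}-y_i)/h$, $(ay_{\bar x})_{x,i}=\bigl(a_{i+1}y_{i+1}-(a_{i+1}+a_i)y_i+a_iy_{i-1}\bigr)/h^2$, $y_{t,i}^n=(y_i^{n+1}-y_i^n)/\tau$, $y^{(\sigma)}=\sigma y^{n+1}+(1-\sigma)y^n$. The discrete Caputo derivative of order $\gamma$ is $$\Delta_{0t_{n+1}}^{\gamma}y_i=\frac{1}{\Gamma(2-\gamma)}\sum_{s=0}^{n}\left(t_{n-s+1}^{1-\gamma}-t_{n-s}^{1-\gamma}\right)y_{t,i}^s .$$ The discrete norm is $\|y\|_0^2=\sum_{i=1}^{N-1}y_i^2h$. The initial function $u_0:[0,1]\to\mathbb R$ satisfies the compatibility condition $u_0(0)=\alpha u_0(1)$, so that $y_0^n=\alpha y_N^n$ also holds for $n=0$. *)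

theory Defs
  imports "HOL-Analysis.Analysis"
begin

(* The grid x_i = i h, h = 1/N, and the time grid t_n = n \<tau>.  A grid function of the
   space variable is a function on nat of which only the values at 0, ..., N matter; a grid
   function y of space and time is written y n i for the value at (x_i, t_n). *)

definition mesh :: "nat \<Rightarrow> real" where
  "mesh N = 1 / real N"

definition node :: "nat \<Rightarrow> nat \<Rightarrow> real" where
  "node N i = real i * mesh N"

definition tnode :: "real \<Rightarrow> nat \<Rightarrow> real" where
  "tnode \<tau> n = real n * \<tau>"

definition acoef :: "(real \<Rightarrow> real) \<Rightarrow> nat \<Rightarrow> nat \<Rightarrow> real" where
  "acoef k N i = k (node N i - 0.5 * mesh N)"

definition bdiff :: "real \<Rightarrow> (nat \<Rightarrow> real) \<Rightarrow> nat \<Rightarrow> real" where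
  "bdiff h y i = (y i - y (i - 1)) / h"

definition fdiff :: "real \<Rightarrow> (nat \<Rightarrow> real) \<Rightarrow> nat \<Rightarrow> real" where
  "fdiff h y i = (y (i + 1) - y i) / h"

(* (a y_xbar)_{x,i}; bdiff and diffusion are used for i \<ge> 1 only, so that i - 1 is exact *)
definition diffusion :: "real \<Rightarrow> (nat \<Rightarrow> real) \<Rightarrow> (nat \<Rightarrow> real) \<Rightarrow> nat \<Rightarrow> real" where
  "diffusion h a y i =
     (a (i + 1) * y (i + 1) - (a (i + 1) + a i) * y i + a i * y (i - 1)) / h\<^sup>2"

definition tdiff :: "real \<Rightarrow> (nat \<Rightarrow> nat \<Rightarrow> real) \<Rightarrow> nat \<Rightarrow> nat \<Rightarrow> real" where
  "tdiff \<tau> y n i = (y (n + 1) i - y n i) / \<tau>"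

definition weighted :: "real \<Rightarrow> (nat \<Rightarrow> nat \<Rightarrow> real) \<Rightarrow> nat \<Rightarrow> nat \<Rightarrow> real" where
  "weighted \<sigma> y n i = \<sigma> * y (n + 1) i + (1 - \<sigma>) * y n i"

(* The discrete Caputo derivative at t_{n+1}.  For s = n the second power is
   0 powr (1 - \<gamma>), which is 0 as it should be. *)
definition caputo :: "real \<Rightarrow> real \<Rightarrow> (nat \<Rightarrow> nat \<Rightarrow> real) \<Rightarrow> nat \<Rightarrow> nat \<Rightarrow> real" where
  "caputo \<gamma> \<tau> y n i =
     1 / Gamma (2 - \<gamma>) *
     (\<Sum>s = 0..n. (tnode \<tau> (n - s + 1) powr (1 - \<gamma>) - tnode \<tau> (n - s) powr (1 - \<gamma>)) * tdiff \<tau> y s i)"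

definition scheme_solution ::
  "(real \<Rightarrow> real) \<Rightarrow> (real \<Rightarrow> real) \<Rightarrow> real \<Rightarrow> real \<Rightarrow> real \<Rightarrow> real \<Rightarrow> real
    \<Rightarrow> nat \<Rightarrow> nat \<Rightarrow> (nat \<Rightarrow> nat \<Rightarrow> real) \<Rightarrow> bool" where
  "scheme_solution k u0 \<alpha> \<beta> \<gamma> \<sigma> T N Nt y \<longleftrightarrow>
     (let h = mesh N; \<tau> = T / real Nt; a = acoef k N in
       (\<forall>n<Nt.
          (\<forall>i\<in>{1..N - 1}. caputo \<gamma> \<tau> y n i - diffusion h a (weighted \<sigma> y n) i = 0) \<and>
          y (n + 1) 0 - \<alpha> * y (n + 1) N = 0 \<and>
          \<beta> * caputo \<gamma> \<tau> y n 0 + caputo \<gamma> \<tau> y n N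
            + 2 / h * (a N * bdiff h (weighted \<sigma> y n) N - \<beta> * a 1 * fdiff h (weighted \<sigma> y n) 0) = 0) \<and>
       (\<forall>i\<in>{0..N}. y 0 i = u0 (node N i)))"

definition norm0 :: "nat \<Rightarrow> (nat \<Rightarrow> real) \<Rightarrow> real" where
  "norm0 N y = sqrt (\<Sum>i = 1..N - 1. (y i)\<^sup>2 * mesh N)"

definition norm0b :: "nat \<Rightarrow> (nat \<Rightarrow> real) \<Rightarrow> real" where
  "norm0b N y = sqrt (1/2 * mesh N * (y 0)\<^sup>2 + 1/2 * mesh N * (y N)\<^sup>2 + (norm0 N y)\<^sup>2)"

(* p1 k N i and p1t k N i are the values at x_i of the weights p_1 and p_1-tilde. *)
definition p1 :: "(real \<Rightarrow> real) \<Rightarrow> nat \<Rightarrow> nat \<Rightarrow> real" where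
  "p1 k N i = sqrt (\<Sum>s = i..<N. mesh N / acoef k N (s + 1))"

definition p1t :: "(real \<Rightarrow> real) \<Rightarrow> nat \<Rightarrow> nat \<Rightarrow> real" where
  "p1t k N i = sqrt (\<Sum>s = i..<N. mesh N / acoef k N (N - s))"

definition delta1 :: "(real \<Rightarrow> real) \<Rightarrow> real \<Rightarrow> real \<Rightarrow> nat \<Rightarrow> real" where
  "delta1 k \<alpha> \<beta> N = (\<beta> * inverse \<alpha> - 1) / (p1 k N 0)\<^sup>2"

definition delta1t :: "(real \<Rightarrow> real) \<Rightarrow> real \<Rightarrow> real \<Rightarrow> nat \<Rightarrow> real" where
  "delta1t k \<alpha> \<beta> N = (\<alpha> * inverse \<beta> - 1) / (p1t k N 0)\<^sup>2"

definition norm1_sq_ge ::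
  "(real \<Rightarrow> real) \<Rightarrow> real \<Rightarrow> real \<Rightarrow> nat \<Rightarrow> (nat \<Rightarrow> real) \<Rightarrow> real" where
  "norm1_sq_ge k \<alpha> \<beta> N y =
     (norm0 N y)\<^sup>2 + delta1 k \<alpha> \<beta> N * (norm0 N (\<lambda>i. p1 k N i * y i))\<^sup>2
     + (\<alpha> * \<beta> + 1) / (2 * \<alpha>\<^sup>2) * (y 0)\<^sup>2 * mesh N"

(* 1 - x_i is the node with index N - i *)
definition norm1_sq_le ::
  "(real \<Rightarrow> real) \<Rightarrow> real \<Rightarrow> real \<Rightarrow> nat \<Rightarrow> (nat \<Rightarrow> real) \<Rightarrow> real" where
  "norm1_sq_le k \<alpha> \<beta> N y =
     (norm0 N y)\<^sup>2 + delta1t k \<alpha> \<beta> N * (\<Sum>i = 1..N - 1. (p1t k N (N - i))\<^sup>2 * (y i)\<^sup>2 * mesh N)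
     + (inverse \<alpha> * inverse \<beta> + 1) / (2 * inverse (\<alpha>\<^sup>2)) * inverse (\<alpha>\<^sup>2) * (y 0)\<^sup>2 * mesh N"

(* The two defining cases overlap only if \<beta> = \<alpha> and \<alpha>\<^sup>2 = 1, where both formulas agree
   (lemma norm1_le below), so the order of the conditional is immaterial. *)
definition norm1 ::
  "(real \<Rightarrow> real) \<Rightarrow> real \<Rightarrow> real \<Rightarrow> nat \<Rightarrow> (nat \<Rightarrow> real) \<Rightarrow> real" where
  "norm1 k \<alpha> \<beta> N y =
     sqrt (if \<beta> * inverse \<alpha> - 1 \<ge> 0 \<and> \<alpha>\<^sup>2 - 1 \<ge> 0
           then norm1_sq_ge k \<alpha> \<beta> N y else norm1_sq_le k \<alpha> \<beta> N y)"

lemma norm1_ge: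
  assumes "\<beta> * inverse \<alpha> - 1 \<ge> 0" "\<alpha>\<^sup>2 - 1 \<ge> 0"
  shows "norm1 k \<alpha> \<beta> N y = sqrt (norm1_sq_ge k \<alpha> \<beta> N y)"
  using assms by (simp add: norm1_def)

lemma norm1_le:
  assumes "\<beta> * inverse \<alpha> - 1 \<le> 0" "\<alpha>\<^sup>2 - 1 \<le> 0"
  shows "norm1 k \<alpha> \<beta> N y = sqrt (norm1_sq_le k \<alpha> \<beta> N y)"
proof (cases "\<beta> * inverse \<alpha> - 1 \<ge> 0 \<and> \<alpha>\<^sup>2 - 1 \<ge> 0")
  case True
  then have *: "\<beta> * inverse \<alpha> = 1" "\<alpha>\<^sup>2 = 1"
    using assms by linarith+
  then have "\<alpha> \<noteq> 0"
    by auto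
  with * have "\<beta> = \<alpha>"
    by (simp add: field_simps)
  with * \<open>\<alpha> \<noteq> 0\<close> show ?thesis
    by (simp add: norm1_def norm1_sq_ge_def norm1_sq_le_def delta1_def delta1t_def power2_eq_square
        flip: inverse_mult_distrib)
next
  case False
  then show ?thesis
    unfolding norm1_def by (simp only: if_False)
qed

end

theory Submission
  imports Defs
begin

text \<open>
  Suppose first that \<beta>/\<alpha> and \<alpha>^2 are at least 1.  On grid functions with y_0 = \<alpha> y_N the squared
  norm is the trapezoidal sum of r_i y_i^2 h with r_i = 1 + \<delta>_1 p_1^2(x_i), where r_0 = \<beta>/\<alpha> and
  r_N = 1.  Summation by parts in this inner product makes the nonlocal boundary flux cancel, and
  with w the weighted solution, g its Caputo derivative and q_i = a_i w_{x-bar,i} the fluxes, it gives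
  (g, w) \<le> - sum (r_i + r_{i-1})/2 q_i^2 h/a_i \<le> - h^2/(4 c_2) (g, g).

  In time, the Caputo derivative is a combination, with nonnegative coefficients, of the differences
  y^{n+1} - y^s.  Hence w g is at least half the Caputo derivative of y^2 plus \<kappa> g^2, where the condition
  on \<sigma> says exactly that \<kappa> + h^2/(4 c_2) \<ge> 0.  So the Caputo derivative of the squared
  norm is nonpositive, and a maximum principle bounds it by its initial value.

  The other case reduces to this one by the reflection x \<mapsto> 1 - x, \<alpha> \<mapsto> 1/\<alpha>, \<beta> \<mapsto> 1/\<beta>.
\<close>

section \<open>Spatial estimate: summation by parts and dissipation by the fluxes\<close>

lemma sum_by_parts:
  fixes f Q :: "nat \<Rightarrow> 'a::comm_ring_1"
  shows "(\<Sum>i = 1..M. f i * (Q i - Q (i - 1))) =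
     f (Suc M) * Q M - f 0 * Q 0 - (\<Sum>i\<le>M. Q i * (f (Suc i) - f i))"
  by (induction M) (simp_all add: algebra_simps)

text \<open>Bound each squared difference by twice the sum of the two squares and regroup by
  \<open>Q i\<close>. The two subtracted terms are the weight that the end fluxes do not receive
  from interior nodes; \<open>energy_dissipation\<close> spends it on the boundary equation.\<close>

lemma sum_sq_diff_le:
  fixes r Q :: "nat \<Rightarrow> real"
  assumes "\<And>i. i \<in> {1..M} \<Longrightarrow> 0 \<le> r i"
  shows "(\<Sum>i = 1..M. r i * (Q i - Q (i - 1))\<^sup>2) \<le>
     2 * (\<Sum>i\<le>M. (r (Suc i) + r i) * (Q i)\<^sup>2) - 2 * r (Suc M) * (Q M)\<^sup>2 - 2 * r 0 * (Q 0)\<^sup>2"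
  using assms
proof (induction M)
  case 0
  then show ?case by (simp add: algebra_simps)
next
  case (Suc M)
  have "0 \<le> r (Suc M) * (Q (Suc M) + Q M)\<^sup>2"
    using Suc.prems by simp
  then have "r (Suc M) * (Q (Suc M) - Q M)\<^sup>2 \<le> 2 * r (Suc M) * ((Q (Suc M))\<^sup>2 + (Q M)\<^sup>2)"
    by (simp add: power2_eq_square algebra_simps)
  moreover note Suc.IH
  ultimately show ?case
    using Suc.prems by (simp add: algebra_simps)
qed

text \<open>Cauchy-Schwarz for the quadratic form with weights 1 and \<beta>/\<alpha>, whose
  constant is 1 + \<beta>^2/(\<beta>/\<alpha>) = 1 + \<alpha>\<beta>. The defect is an explicit
  square.\<close>

lemma boundary_flux_le:
  fixes \<alpha> \<beta> p q :: real
  assumes "\<alpha> * \<beta> > 0"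
  shows "(p - \<beta> * q)\<^sup>2 \<le> (\<alpha> * \<beta> + 1) * (p\<^sup>2 + \<beta> / \<alpha> * q\<^sup>2)"
proof -
  have "\<alpha> \<noteq> 0" using assms by auto
  then have "(\<alpha> * \<beta> + 1) * (p\<^sup>2 + \<beta> / \<alpha> * q\<^sup>2) - (p - \<beta> * q)\<^sup>2 = \<alpha> * \<beta> * (p + q / \<alpha>)\<^sup>2"
    by (simp add: field_simps power2_eq_square)
  moreover have "0 \<le> \<alpha> * \<beta> * (p + q / \<alpha>)\<^sup>2"
    using assms by simp
  ultimately show ?thesis by linarith
qed

text \<open>By \<open>r_step\<close> the weight \<open>r\<close> has constant discrete flux, so
  differencing \<open>r\<close> in the product r w leaves only a telescoping sum, whose sign is
  settled by w_0 = \<alpha> w_N and \<alpha>^2 \<ge> 1. What remains is a weighted sum of squared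
  fluxes, and it controls (g, g) because g h is a difference of fluxes.\<close>

lemma energy_dissipation:
  fixes r a w g :: "nat \<Rightarrow> real"
  assumes "N \<ge> 1" "h > 0" "\<alpha> * \<beta> > 0" "\<alpha>\<^sup>2 \<ge> 1" "\<delta> \<ge> 0"
    and a: "\<And>i. i \<in> {1..N} \<Longrightarrow> 0 < a i \<and> a i \<le> c"
    and r_step: "\<And>i. i < N \<Longrightarrow> (r i - r (i + 1)) * a (i + 1) = \<delta> * h"
    and r_ge: "\<And>i. i \<le> N \<Longrightarrow> r i \<ge> 0"
    and r_bd: "r N = 1" "r 0 = \<beta> / \<alpha>"
    and w: "w 0 = \<alpha> * w N"
    and int: "\<And>i. i \<in> {1..N - 1} \<Longrightarrow> g i = diffusion h a w i"
    and bd: "(\<alpha> * \<beta> + 1) * g N + 2 / h * (a N * bdiff h w N - \<beta> * a 1 * fdiff h w 0) = 0"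
  shows "(\<Sum>i = 1..N - 1. r i * (g i * w i) * h) + (\<alpha> * \<beta> + 1) / 2 * (g N * w N) * h
    \<le> - (h\<^sup>2 / (4 * c)) *
       ((\<Sum>i = 1..N - 1. r i * (g i)\<^sup>2 * h) + (\<alpha> * \<beta> + 1) / 2 * (g N)\<^sup>2 * h)"
proof -
  obtain M where N: "N = Suc M"
    using \<open>N \<ge> 1\<close> by (cases N) auto
  \<comment> \<open>\<open>Q i\<close> is the flux between nodes i and i + 1. The end fluxes are
    thus \<open>Q 0\<close> and \<open>Q M\<close>, and the boundary equation becomes a balance of
    these two.\<close>
  define Q where "Q i = a (Suc i) * (w (Suc i) - w i) / h" for i
  have c: "c > 0"
    using a[of 1] \<open>N \<ge> 1\<close> by force
  have gQ: "Q i - Q (i - Suc 0) = g i * h" if "i \<in> {1..M}" for i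
  proof -
    have "g i = diffusion h a w i"
      using int[of i] that N by simp
    then show ?thesis
      using that \<open>h > 0\<close>
      by (simp add: diffusion_def Q_def power2_eq_square) (simp add: field_simps)
  qed
  have bdQ: "(\<alpha> * \<beta> + 1) / 2 * g N * h = - (Q M - \<beta> * Q 0)"
    using bd \<open>h > 0\<close> by (simp add: N bdiff_def fdiff_def Q_def field_simps)
  define D where "D = (\<Sum>i\<le>M. (r (Suc i) + r i) * (Q i)\<^sup>2)"
  \<comment> \<open>The difference of a product is (mean of r)(difference of w) + (difference of
    r)(mean of w). The first part gives the squared flux; by \<open>r_step\<close> the second is a
    multiple of a difference of squares.\<close>
  have eq: "Q i * (r (Suc i) * w (Suc i) - r i * w i) =
      (r (Suc i) + r i) * (Q i)\<^sup>2 * h / (2 * a (Suc i)) - \<delta> / 2 * ((w (Suc i))\<^sup>2 - (w i)\<^sup>2)"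
    if "i \<le> M" for i
  proof -
    have a': "a (Suc i) > 0" using a that N by simp
    have \<delta>: "(r i - r (Suc i)) * a (Suc i) = \<delta> * h" using r_step[of i] that N by simp
    have "Q i * (r (Suc i) * w (Suc i) - r i * w i) =
       Q i * ((r (Suc i) + r i) * (w (Suc i) - w i)) / 2 - Q i * (r i - r (Suc i)) * (w (Suc i) + w i) / 2"
      by (simp add: field_simps)
    also have "Q i * (r i - r (Suc i)) = (r i - r (Suc i)) * a (Suc i) * ((w (Suc i) - w i) / h)"
      by (simp add: Q_def)
    also have "\<dots> = \<delta> * (w (Suc i) - w i)"
      unfolding \<delta> using \<open>h > 0\<close> by simp
    finally have "Q i * (r (Suc i) * w (Suc i) - r i * w i) =
        Q i * ((r (Suc i) + r i) * (w (Suc i) - w i)) / 2 - \<delta> / 2 * ((w (Suc i))\<^sup>2 - (w i)\<^sup>2)"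
      by (simp add: square_diff_square_factored power2_eq_square mult_ac)
    moreover have "w (Suc i) - w i = Q i * h / a (Suc i)"
      using a' \<open>h > 0\<close> by (simp add: Q_def)
    ultimately show ?thesis
      by (simp add: power2_eq_square mult_ac)
  qed
  have tele: "(\<Sum>i\<le>M. (w (Suc i))\<^sup>2 - (w i)\<^sup>2) = (w N)\<^sup>2 - (w 0)\<^sup>2"
    using sum_telescope[of "\<lambda>i. - (w i)\<^sup>2" M] N by simp
  have tele_le: "\<delta> / 2 * ((w N)\<^sup>2 - (w 0)\<^sup>2) \<le> 0"
    using mult_right_mono[OF \<open>\<alpha>\<^sup>2 \<ge> 1\<close>, of "(w N)\<^sup>2"] \<open>\<delta> \<ge> 0\<close>
    by (intro mult_nonneg_nonpos) (auto simp: w power_mult_distrib)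
  have "D * h / (2 * c) = (\<Sum>i\<le>M. (r (Suc i) + r i) * (Q i)\<^sup>2 * h / (2 * c))"
    by (simp add: D_def sum_distrib_right sum_divide_distrib)
  also have "\<dots> \<le> (\<Sum>i\<le>M. (r (Suc i) + r i) * (Q i)\<^sup>2 * h / (2 * a (Suc i)))"
    using r_ge a N c \<open>h > 0\<close> by (intro sum_mono divide_left_mono mult_nonneg_nonneg) auto
  finally have D: "D * h / (2 * c) \<le> \<dots>" .
  have "(\<Sum>i = 1..N - 1. r i * (g i * w i) * h) = (\<Sum>i = 1..M. (r i * w i) * (Q i - Q (i - 1)))"
    by (intro sum.cong) (simp_all add: N gQ)
  \<comment> \<open>At the left end r_0 w_0 = (\<beta>/\<alpha>)(\<alpha> w_N) = \<beta> w_N, which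
    is what the prescribed value of \<open>r 0\<close> is for.\<close>
  also have "\<dots> = w N * Q M - \<beta> * w N * Q 0 - (\<Sum>i\<le>M. Q i * (r (Suc i) * w (Suc i) - r i * w i))"
    using r_bd w N assms(3) by (subst sum_by_parts) auto
  also have "(\<Sum>i\<le>M. Q i * (r (Suc i) * w (Suc i) - r i * w i)) =
     (\<Sum>i\<le>M. (r (Suc i) + r i) * (Q i)\<^sup>2 * h / (2 * a (Suc i))) - \<delta> / 2 * ((w N)\<^sup>2 - (w 0)\<^sup>2)"
  proof -
    have "(\<Sum>i\<le>M. Q i * (r (Suc i) * w (Suc i) - r i * w i)) =
      (\<Sum>i\<le>M. (r (Suc i) + r i) * (Q i)\<^sup>2 * h / (2 * a (Suc i)) - \<delta> / 2 * ((w (Suc i))\<^sup>2 - (w i)\<^sup>2))"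
      by (intro sum.cong refl eq) simp
    then show ?thesis
      unfolding tele[symmetric] by (simp add: sum_subtractf sum_distrib_left right_diff_distrib)
  qed
  finally have "(\<Sum>i = 1..N - 1. r i * (g i * w i) * h) + (\<alpha> * \<beta> + 1) / 2 * (g N * w N) * h
      \<le> - (D * h / (2 * c)) + (w N * Q M - \<beta> * w N * Q 0 + ((\<alpha> * \<beta> + 1) / 2 * g N * h) * w N)"
    using D tele_le by (simp add: mult_ac)
  \<comment> \<open>The boundary equation multiplied by w_N cancels both end fluxes exactly.\<close>
  also have "\<dots> = - (D * h / (2 * c))"
    unfolding bdQ by (simp add: algebra_simps)
  finally have 1: "(\<Sum>i = 1..N - 1. r i * (g i * w i) * h) + (\<alpha> * \<beta> + 1) / 2 * (g N * w N) * h
      \<le> - (D * h / (2 * c))" .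
  have "(\<Sum>i = 1..N - 1. r i * (g i)\<^sup>2 * h) * h = (\<Sum>i = 1..M. r i * (Q i - Q (i - 1))\<^sup>2)"
    unfolding sum_distrib_right by (intro sum.cong) (simp_all add: N gQ power2_eq_square mult_ac)
  also have "\<dots> \<le> 2 * D - 2 * (Q M)\<^sup>2 - 2 * (\<beta> / \<alpha>) * (Q 0)\<^sup>2"
    using sum_sq_diff_le[of M r Q] r_ge r_bd N by (simp add: D_def)
  finally have 2: "(\<Sum>i = 1..N - 1. r i * (g i)\<^sup>2 * h) * h \<le> \<dots>" .
  \<comment> \<open>The extra factor \<alpha>\<beta> + 1 completes the square of the boundary
    balance \<open>bdQ\<close>. The resulting bound matches the end terms subtracted in the estimate
    of the interior sum, so the two add up to at most 2 D.\<close>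
  have "(\<alpha> * \<beta> + 1) * ((\<alpha> * \<beta> + 1) / 2 * (g N)\<^sup>2 * h * h) = 2 * ((\<alpha> * \<beta> + 1) / 2 * g N * h)\<^sup>2"
    by (simp add: power2_eq_square)
  also have "\<dots> = 2 * (Q M - \<beta> * Q 0)\<^sup>2"
    unfolding bdQ by (simp add: power2_commute)
  also have "\<dots> \<le> (\<alpha> * \<beta> + 1) * (2 * (Q M)\<^sup>2 + 2 * (\<beta> / \<alpha>) * (Q 0)\<^sup>2)"
  proof -
    have eq: "2 * (A * (P + C * R)) = A * (2 * P + 2 * C * R)" for A P C R :: real
      by (simp add: algebra_simps)
    show ?thesis
      unfolding eq[symmetric]
      by (intro mult_left_mono boundary_flux_le assms(3)) simp
  qed
  finally have 3: "(\<alpha> * \<beta> + 1) / 2 * (g N)\<^sup>2 * h * h \<le> 2 * (Q M)\<^sup>2 + 2 * (\<beta> / \<alpha>) * (Q 0)\<^sup>2"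
    using assms(3) by (simp add: mult_le_cancel_left_pos)
  have "((\<Sum>i = 1..N - 1. r i * (g i)\<^sup>2 * h) + (\<alpha> * \<beta> + 1) / 2 * (g N)\<^sup>2 * h) * h \<le> 2 * D"
    unfolding distrib_right using 2 3 by linarith
  \<comment> \<open>The factor h/(4c) turns 2 D into D h/(2c), the dissipation found above; this is
    the origin of the constant h^2/(4c).\<close>
  then have "(h / (4 * c)) * (((\<Sum>i = 1..N - 1. r i * (g i)\<^sup>2 * h) + (\<alpha> * \<beta> + 1) / 2 * (g N)\<^sup>2 * h) * h)
     \<le> (h / (4 * c)) * (2 * D)"
    using c \<open>h > 0\<close> by (intro mult_left_mono) auto
  with 1 show ?thesis
    by (simp add: power2_eq_square mult_ac)
qed

section \<open>Time estimate: the discrete Caputo derivative and its weights\<close>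

lemma powr_increment_decreasing:
  fixes x p :: real
  assumes "0 < p" "p < 1" "0 \<le> x"
  shows "(x + 2) powr p - (x + 1) powr p \<le> (x + 1) powr p - x powr p"
proof -
  \<comment> \<open>The left end u = 0 is allowed, where the power is continuous but not
    differentiable; the mean value theorem asks for the derivative only inside the interval.\<close>
  have cont: "continuous_on {u..u + 1} (\<lambda>t. t powr p)" if "0 \<le> u" for u :: real
    using assms that by (intro continuous_on_powr') (auto intro!: continuous_intros)
  have der: "((\<lambda>t. t powr p) has_real_derivative p * t powr (p - 1)) (at t)" if "0 < t" for t :: real
    using that by (rule has_real_derivative_powr)
  have mvt: "\<exists>t. u < t \<and> t < u + 1 \<and> (u + 1) powr p - u powr p = p * t powr (p - 1)" if "0 \<le> u" for u :: real
  proof -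
    have diff: "(\<lambda>t. t powr p) differentiable (at t)" if "u < t" for t
      using der[of t] that \<open>0 \<le> u\<close> by (auto simp: real_differentiable_def)
    obtain l t where t: "u < t" "t < u + 1" and l: "((\<lambda>t. t powr p) has_real_derivative l) (at t)"
      and eq: "(u + 1) powr p - u powr p = (u + 1 - u) * l"
      using MVT[of u "u + 1" "\<lambda>t. t powr p", OF _ cont[OF \<open>0 \<le> u\<close>] diff] by auto
    have "l = p * t powr (p - 1)"
      using DERIV_unique[OF l der] t that by simp
    with t eq show ?thesis by auto
  qed
  obtain s where s: "x < s" "s < x + 1" "(x + 1) powr p - x powr p = p * s powr (p - 1)"
    using mvt[of x] assms by auto
  obtain t where t: "x + 1 < t" "(x + 2) powr p - (x + 1) powr p = p * t powr (p - 1)"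
    using mvt[of "x + 1"] assms by (auto simp: add.assoc)
  \<comment> \<open>The intermediate points satisfy s < x + 1 < t, and the exponent p - 1 is
    negative.\<close>
  have "t powr (p - 1) \<le> s powr (p - 1)"
    using s t assms by (intro powr_mono2') auto
  with s t assms show ?thesis by simp
qed

text \<open>Abel summation: each increment of v is e_s - e_{s+1}, where e_s is the distance to the
  newest value and e_{n+1} = 0. For decreasing nonnegative d all new coefficients are
  nonnegative.\<close>

lemma convolution_difference_form:
  fixes d v :: "nat \<Rightarrow> real"
  shows "(\<Sum>s\<le>n. d (n - s) * (v (Suc s) - v s)) =
     (\<Sum>s\<le>n. (if s = 0 then d n else d (n - s) - d (Suc n - s)) * (v (Suc n) - v s))"
proof -
  define e where "e s = v (Suc n) - v s" for s
  have "(\<Sum>s\<le>n. d (n - s) * e (Suc s)) = (\<Sum>s<n. d (n - s) * e (Suc s))"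
    by (simp add: lessThan_Suc_atMost[symmetric] e_def)
  also have "\<dots> = (\<Sum>s\<in>{1..n}. d (Suc n - s) * e s)"
    by (rule sum.reindex_bij_witness[of _ "\<lambda>s. s - 1" Suc]) auto
  finally have 1: "(\<Sum>s\<le>n. d (n - s) * e (Suc s)) = \<dots>" .
  have 2: "sum f {..n} = f 0 + sum f {1..n}" for f :: "nat \<Rightarrow> real"
    by (simp add: sum.atLeast1_atMost_eq sum.atMost_shift)
  have "(\<Sum>s\<le>n. d (n - s) * (v (Suc s) - v s)) = (\<Sum>s\<le>n. d (n - s) * e s) - (\<Sum>s\<le>n. d (n - s) * e (Suc s))"
    by (simp add: e_def sum_subtractf[symmetric] algebra_simps)
  also have "\<dots> = d n * e 0 + (\<Sum>s\<in>{1..n}. (d (n - s) - d (Suc n - s)) * e s)"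
    unfolding 1 2 by (simp add: sum_subtractf algebra_simps)
  also have "\<dots> = (\<Sum>s\<le>n. (if s = 0 then d n else d (n - s) - d (Suc n - s)) * e s)"
    unfolding 2 by (auto intro!: sum.cong)
  finally show ?thesis by (simp add: e_def)
qed

lemma caputo_weights:
  fixes \<gamma> \<tau> :: real
  assumes "0 < \<gamma>" "\<gamma> < 1" "\<tau> > 0"
  obtains c :: "nat \<Rightarrow> real"
  where "\<And>s. s \<le> n \<Longrightarrow> 0 \<le> c s"
    and "sum c {..n} = 1 / (\<tau> powr \<gamma> * Gamma (2 - \<gamma>))"
    and "c n \<ge> (2 - 2 powr (1 - \<gamma>)) / (\<tau> powr \<gamma> * Gamma (2 - \<gamma>))"
    and "\<And>y i. caputo \<gamma> \<tau> y n i = (\<Sum>s\<le>n. c s * (y (n + 1) i - y s i))"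
proof -
  define C where "C = 1 / (\<tau> powr \<gamma> * Gamma (2 - \<gamma>))"
  have "Gamma (2 - \<gamma>) > 0"
    using assms by (intro Gamma_real_pos) auto
  then have C: "C > 0" using assms by (simp add: C_def)
  define d where "d j = C * ((real j + 1) powr (1 - \<gamma>) - real j powr (1 - \<gamma>))" for j :: nat
  define c where "c s = (if s = 0 then d n else d (n - s) - d (Suc n - s))" for s
  have d_nonneg: "0 \<le> d j" for j
    using C assms by (auto simp: d_def intro!: mult_nonneg_nonneg powr_mono2)
  have d_Suc: "d (Suc j) \<le> d j" for j
    using C powr_increment_decreasing[of "1 - \<gamma>" "real j"] assms
    by (auto simp: d_def add_ac intro!: mult_left_mono)
  have d0: "d 0 = C" by (simp add: d_def)
  have d1: "d 0 - d 1 = (2 - 2 powr (1 - \<gamma>)) * C" by (simp add: d_def algebra_simps)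
  show ?thesis
  proof (rule that[of c])
    show "0 \<le> c s" if "s \<le> n" for s
      using d_nonneg d_Suc[of "n - s"] that by (auto simp: c_def Suc_diff_le)
    \<comment> \<open>The total weight comes from testing the identity on the indicator of level n +
      1: every difference from the newest value is 1, while only the last increment survives, with
      coefficient \<open>d 0\<close>.\<close>
    have "(\<Sum>s\<le>n. d (n - s) * ((if Suc s = Suc n then 1 else 0) - (if s = Suc n then 1 else 0))) =
        (\<Sum>s\<le>n. if s = n then d 0 else 0)"
      by (intro sum.cong) auto
    moreover have "sum c {..n} = (\<Sum>s\<le>n. c s * ((if Suc n = Suc n then 1 else 0) - (if s = Suc n then 1 else 0)))"
      by (intro sum.cong) auto
    ultimately show "sum c {..n} = 1 / (\<tau> powr \<gamma> * Gamma (2 - \<gamma>))"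
      using convolution_difference_form[of d n "\<lambda>s. if s = Suc n then 1 else 0"] d0
      by (simp add: c_def C_def)
    \<comment> \<open>For n > 0 this is the equality c_n = d_0 - d_1. For n = 0 the only weight is
      d_0, which is larger; hence an inequality that serves all n.\<close>
    show "c n \<ge> (2 - 2 powr (1 - \<gamma>)) / (\<tau> powr \<gamma> * Gamma (2 - \<gamma>))"
      using d1 d_nonneg[of 1] by (auto simp: c_def C_def)
    fix y :: "nat \<Rightarrow> nat \<Rightarrow> real" and i
    \<comment> \<open>Homogeneity in \<tau>: \<tau>^(1-\<gamma>) from the powers and 1/\<tau> from
      \<open>tdiff\<close> combine to \<tau>^(-\<gamma>).\<close>
    have weight: "1 / Gamma (2 - \<gamma>) * ((tnode \<tau> (j + 1) powr (1 - \<gamma>) - tnode \<tau> j powr (1 - \<gamma>)) / \<tau>) = d j" for j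
    proof -
      have tnode: "tnode \<tau> m powr (1 - \<gamma>) = real m powr (1 - \<gamma>) * (\<tau> / \<tau> powr \<gamma>)" for m
        using assms by (simp add: tnode_def powr_mult powr_diff)
      then show ?thesis
        unfolding tnode left_diff_distrib[symmetric] using assms by (simp add: d_def C_def add_ac)
    qed
    have "caputo \<gamma> \<tau> y n i = (\<Sum>s\<le>n. d (n - s) * (y (Suc s) i - y s i))"
      unfolding caputo_def sum_distrib_left atLeast0AtMost weight[symmetric] tdiff_def
      by (intro sum.cong) (simp_all add: mult_ac)
    also have "\<dots> = (\<Sum>s\<le>n. c s * (y (Suc n) i - y s i))"
      unfolding c_def by (rule convolution_difference_form)
    finally show "caputo \<gamma> \<tau> y n i = (\<Sum>s\<le>n. c s * (y (n + 1) i - y s i))" by simp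
  qed
qed

text \<open>The new and old levels are treated separately and then averaged with \<sigma>. In terms
  of X, Y, Z below, v_{n+1} X = Z/2 + Y/2, and Y \<ge> X^2/d gives a gain. Replacing v_{n+1} by v_n
  costs e_n X, which the part of Y at s = n absorbs up to X^2/(2d').\<close>

lemma weighted_mult_caputo_ge:
  fixes c e v :: "nat \<Rightarrow> real"
  assumes c: "\<And>s. s \<le> n \<Longrightarrow> 0 \<le> c s" and pos: "0 < d" "0 < d'"
    and d: "sum c {..n} = d" and d': "d' \<le> c n" and \<sigma>: "0 \<le> \<sigma>" "\<sigma> \<le> 1"
  shows "(\<sigma> * v (Suc n) + (1 - \<sigma>) * v n) * (\<Sum>s\<le>n. c s * (v (Suc n) - v s)) \<ge>
     1/2 * (\<Sum>s\<le>n. c s * ((v (Suc n))\<^sup>2 - (v s)\<^sup>2))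
     + 1/2 * (\<sigma> / d - (1 - \<sigma>) / d') * (\<Sum>s\<le>n. c s * (v (Suc n) - v s))\<^sup>2"
proof -
  define e where "e s = v (Suc n) - v s" for s
  define X where "X = (\<Sum>s\<le>n. c s * e s)"
  define Y where "Y = (\<Sum>s\<le>n. c s * (e s)\<^sup>2)"
  define Z where "Z = (\<Sum>s\<le>n. c s * ((v (Suc n))\<^sup>2 - (v s)\<^sup>2))"
  have Z: "Z = 2 * v (Suc n) * X - Y"
    unfolding X_def Y_def Z_def sum_distrib_left sum_subtractf[symmetric]
    by (intro sum.cong) (simp_all add: e_def power2_eq_square algebra_simps)
  have XY: "X\<^sup>2 \<le> d * Y"
  proof -
    \<comment> \<open>Splitting each weight into two square roots prepares Cauchy-Schwarz with total
      weight d.\<close>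
    have "X = (\<Sum>s\<le>n. sqrt (c s) * (sqrt (c s) * e s))"
      unfolding X_def using c by (intro sum.cong) (simp_all flip: mult.assoc)
    then have "X\<^sup>2 \<le> (\<Sum>s\<le>n. (sqrt (c s))\<^sup>2) * (\<Sum>s\<le>n. (sqrt (c s) * e s)\<^sup>2)"
      using Cauchy_Schwarz_ineq_sum by metis
    also have "\<dots> = d * Y"
      using c d by (simp add: Y_def power_mult_distrib)
    finally show ?thesis .
  qed
  have cn: "d' * (e n)\<^sup>2 \<le> Y"
  proof -
    have "d' * (e n)\<^sup>2 \<le> c n * (e n)\<^sup>2" using d' by (intro mult_right_mono) auto
    also have "\<dots> \<le> Y"
      unfolding Y_def using c by (intro member_le_sum) auto
    finally show ?thesis .
  qed
  have new: "v (Suc n) * X \<ge> 1/2 * Z + 1/2 * (1 / d) * X\<^sup>2"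
    using XY pos by (simp add: Z field_simps)
  \<comment> \<open>Completing the square bounds the cross term 2 e_n X by d' e_n^2 +
    X^2/d'.\<close>
  have "0 \<le> (d' * e n - X)\<^sup>2 / d'"
    using pos by simp
  also have "\<dots> = d' * (e n)\<^sup>2 - 2 * e n * X + X\<^sup>2 / d'"
    using pos by (simp add: power2_eq_square field_simps)
  finally have "Y - 2 * e n * X + X\<^sup>2 / d' \<ge> 0"
    using cn by linarith
  moreover have "v n * X = v (Suc n) * X - e n * X"
    by (simp add: e_def algebra_simps)
  ultimately have old: "v n * X \<ge> 1/2 * Z - 1/2 * (1 / d') * X\<^sup>2"
    by (simp add: Z diff_divide_distrib)
  have "\<sigma> * (v (Suc n) * X) + (1 - \<sigma>) * (v n * X) \<ge>
     \<sigma> * (1/2 * Z + 1/2 * (1 / d) * X\<^sup>2) + (1 - \<sigma>) * (1/2 * Z - 1/2 * (1 / d') * X\<^sup>2)"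
    using \<sigma> new old by (intro add_mono mult_left_mono) auto
  then have "(\<sigma> * v (Suc n) + (1 - \<sigma>) * v n) * X \<ge> 1/2 * Z + 1/2 * (\<sigma> / d - (1 - \<sigma>) / d') * X\<^sup>2"
    using pos by (simp add: field_simps)
  then show ?thesis by (simp add: X_def Z_def e_def)
qed

section \<open>The weighted energy and its relation to the norms\<close>

lemma acoef_bounds:
  assumes "\<And>x. x \<in> {0..1} \<Longrightarrow> c1 \<le> k x \<and> k x \<le> c2" and "i \<in> {1..N}"
  shows "c1 \<le> acoef k N i \<and> acoef k N i \<le> c2"
proof -
  have "node N i - 0.5 * mesh N \<in> {0..1}"
    using assms(2) by (auto simp: node_def mesh_def field_simps)
  with assms(1) show ?thesis by (simp add: acoef_def)
qed

text \<open>For positive coefficients this is the discrete solution of (a r_{x-bar})_x = 0 with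
  boundary values \<beta>/\<alpha> and 1; \<open>delta1\<close> is the normalisation at the left
  end.\<close>

definition energy_weight :: "(real \<Rightarrow> real) \<Rightarrow> real \<Rightarrow> real \<Rightarrow> nat \<Rightarrow> nat \<Rightarrow> real" where
  "energy_weight k \<alpha> \<beta> N i = 1 + delta1 k \<alpha> \<beta> N * (p1 k N i)\<^sup>2"

text \<open>A linear functional, so that it applies alike to y^2, g^2 and g w. The left end is
  folded into the term at N: such products satisfy f_0 = \<alpha>^2 f_N, and (r_0 \<alpha>^2 +
  r_N)/2 = (\<alpha>\<beta> + 1)/2.\<close>

definition energy :: "(real \<Rightarrow> real) \<Rightarrow> real \<Rightarrow> real \<Rightarrow> nat \<Rightarrow> (nat \<Rightarrow> real) \<Rightarrow> real" where
  "energy k \<alpha> \<beta> N f =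
     (\<Sum>i = 1..N - 1. energy_weight k \<alpha> \<beta> N i * f i * mesh N) + (\<alpha> * \<beta> + 1) / 2 * f N * mesh N"

lemma energy_sum: "energy k \<alpha> \<beta> N (\<lambda>i. \<Sum>s\<in>S. f s i) = (\<Sum>s\<in>S. energy k \<alpha> \<beta> N (f s))"
  by (simp add: energy_def sum.distrib sum_distrib_left sum_distrib_right sum.swap[of _ S])

lemma energy_add: "energy k \<alpha> \<beta> N (\<lambda>i. f i + g i) = energy k \<alpha> \<beta> N f + energy k \<alpha> \<beta> N g"
  by (simp add: energy_def sum.distrib distrib_left distrib_right)

lemma energy_diff: "energy k \<alpha> \<beta> N (\<lambda>i. f i - g i) = energy k \<alpha> \<beta> N f - energy k \<alpha> \<beta> N g"
  by (simp add: energy_def sum_subtractf left_diff_distrib right_diff_distrib)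

lemma energy_scale: "energy k \<alpha> \<beta> N (\<lambda>i. c * f i) = c * energy k \<alpha> \<beta> N f"
  by (simp add: energy_def sum_distrib_left distrib_left mult_ac)

lemma norm0_square: "(norm0 N y)\<^sup>2 = (\<Sum>i = 1..N - 1. (y i)\<^sup>2 * mesh N)"
  by (simp add: norm0_def sum_nonneg mesh_def)

lemma norm1_sq_ge_eq_energy:
  assumes "\<alpha> \<noteq> 0" "y 0 = \<alpha> * y N"
  shows "norm1_sq_ge k \<alpha> \<beta> N y = energy k \<alpha> \<beta> N (\<lambda>i. (y i)\<^sup>2)"
proof -
  have "(\<alpha> * \<beta> + 1) / (2 * \<alpha>\<^sup>2) * (y 0)\<^sup>2 = (\<alpha> * \<beta> + 1) / 2 * (y N)\<^sup>2"
    using assms by (simp add: power_mult_distrib)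
  moreover have "(norm0 N y)\<^sup>2 + delta1 k \<alpha> \<beta> N * (norm0 N (\<lambda>i. p1 k N i * y i))\<^sup>2
      = (\<Sum>i = 1..N - 1. energy_weight k \<alpha> \<beta> N i * (y i)\<^sup>2 * mesh N)"
    by (simp add: energy_weight_def norm0_square power_mult_distrib
        sum.distrib sum_distrib_left algebra_simps)
  ultimately show ?thesis
    by (simp only: norm1_sq_ge_def energy_def)
qed

context
  fixes k :: "real \<Rightarrow> real" and N :: nat
  assumes N: "N \<ge> 1" and a_pos: "\<And>i. i \<in> {1..N} \<Longrightarrow> 0 < acoef k N i"
begin

lemma p1_square: "(p1 k N i)\<^sup>2 = (\<Sum>s = i..<N. mesh N / acoef k N (s + 1))"
  using a_pos by (auto simp: p1_def mesh_def less_imp_le intro!: sum_nonneg)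

lemma p1_0_pos: "0 < (p1 k N 0)\<^sup>2"
  unfolding p1_square using a_pos N by (intro sum_pos) (auto simp: mesh_def)

lemma delta1_nonneg: "\<beta> * inverse \<alpha> \<ge> 1 \<Longrightarrow> 0 \<le> delta1 k \<alpha> \<beta> N"
  by (simp add: delta1_def)

lemma energy_weight_N: "energy_weight k \<alpha> \<beta> N N = 1"
  by (simp add: energy_weight_def p1_square)

lemma energy_weight_0: "energy_weight k \<alpha> \<beta> N 0 = \<beta> / \<alpha>"
  using p1_0_pos by (simp add: energy_weight_def delta1_def) (simp add: divide_inverse)

lemma energy_weight_ge_1: "\<beta> * inverse \<alpha> \<ge> 1 \<Longrightarrow> 1 \<le> energy_weight k \<alpha> \<beta> N i"
  by (simp add: energy_weight_def delta1_nonneg)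

lemma energy_weight_step:
  assumes "i < N"
  shows "(energy_weight k \<alpha> \<beta> N i - energy_weight k \<alpha> \<beta> N (i + 1)) * acoef k N (i + 1)
    = delta1 k \<alpha> \<beta> N * mesh N"
proof -
  have "(p1 k N i)\<^sup>2 = mesh N / acoef k N (i + 1) + (p1 k N (i + 1))\<^sup>2"
    using assms by (simp add: p1_square sum.atLeast_Suc_lessThan)
  then show ?thesis
    using a_pos[of "i + 1"] assms by (simp add: energy_weight_def algebra_simps)
qed

lemma energy_weight_le:
  assumes "\<beta> * inverse \<alpha> \<ge> 1"
  shows "energy_weight k \<alpha> \<beta> N i \<le> \<beta> / \<alpha>"
proof -
  have "(p1 k N i)\<^sup>2 \<le> (p1 k N 0)\<^sup>2"
    unfolding p1_square using a_pos
    by (intro sum_mono2) (auto simp: mesh_def less_imp_le)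
  then have "energy_weight k \<alpha> \<beta> N i \<le> energy_weight k \<alpha> \<beta> N 0"
    using delta1_nonneg[OF assms] by (simp add: energy_weight_def mult_left_mono)
  then show ?thesis by (simp add: energy_weight_0)
qed

lemma energy_mono:
  assumes "\<beta> * inverse \<alpha> \<ge> 1" "\<alpha> * \<beta> > 0" "\<And>i. f i \<le> g i"
  shows "energy k \<alpha> \<beta> N f \<le> energy k \<alpha> \<beta> N g"
proof -
  have "0 \<le> energy_weight k \<alpha> \<beta> N i" for i
    using energy_weight_ge_1[OF assms(1), of i] by linarith
  then show ?thesis
    unfolding energy_def using assms
    by (intro add_mono sum_mono mult_right_mono mult_left_mono) (auto simp: mesh_def)
qed

text \<open>All nodal weights lie between 1 and \<beta>/\<alpha>. After y_0 is eliminated the end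
  weights \<alpha>^2 + 1 and \<alpha>\<beta> + 1 are related by the same two factors, since
  \<alpha>\<beta> = (\<beta>/\<alpha>) \<alpha>^2.\<close>

lemma norm1_sq_ge_bounds:
  assumes "\<beta> * inverse \<alpha> \<ge> 1" "\<alpha> * \<beta> > 0" "\<alpha>\<^sup>2 \<ge> 1" "y 0 = \<alpha> * y N"
  shows "(norm0b N y)\<^sup>2 \<le> norm1_sq_ge k \<alpha> \<beta> N y"
    and "norm1_sq_ge k \<alpha> \<beta> N y \<le> \<beta> / \<alpha> * (norm0b N y)\<^sup>2"
proof -
  have \<alpha>: "\<alpha> \<noteq> 0" using assms by auto
  have h: "mesh N > 0" using N by (simp add: mesh_def)
  have ratio: "\<beta> / \<alpha> \<ge> 1" using assms(1) by (simp add: divide_inverse)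
  have \<alpha>\<beta>: "\<alpha> * \<beta> = \<beta> / \<alpha> * \<alpha>\<^sup>2" using \<alpha> by (simp add: power2_eq_square)
  have norm0b: "(norm0b N y)\<^sup>2 =
      (\<Sum>i = 1..N - 1. (y i)\<^sup>2 * mesh N) + (\<alpha>\<^sup>2 + 1) / 2 * (y N)\<^sup>2 * mesh N"
    using h by (simp add: norm0b_def norm0_square sum_nonneg assms(4) power_mult_distrib field_simps)
  have ends: "\<alpha>\<^sup>2 + 1 \<le> \<alpha> * \<beta> + 1" "\<alpha> * \<beta> + 1 \<le> \<beta> / \<alpha> * (\<alpha>\<^sup>2 + 1)"
    unfolding \<alpha>\<beta> using ratio mult_right_mono[OF ratio, of "\<alpha>\<^sup>2"] by (simp_all add: distrib_left)
  have "(y i)\<^sup>2 \<le> energy_weight k \<alpha> \<beta> N i * (y i)\<^sup>2" for i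
    using mult_right_mono[OF energy_weight_ge_1[OF assms(1)], of "(y i)\<^sup>2"] by simp
  then show "(norm0b N y)\<^sup>2 \<le> norm1_sq_ge k \<alpha> \<beta> N y"
    unfolding norm0b norm1_sq_ge_eq_energy[where k = k and \<beta> = \<beta>, OF \<alpha> assms(4)] energy_def
    using h ends
    by (intro add_mono sum_mono mult_right_mono) auto
  have "energy k \<alpha> \<beta> N (\<lambda>i. (y i)\<^sup>2) \<le>
      (\<Sum>i = 1..N - 1. \<beta> / \<alpha> * (y i)\<^sup>2 * mesh N) + \<beta> / \<alpha> * (\<alpha>\<^sup>2 + 1) / 2 * (y N)\<^sup>2 * mesh N"
    unfolding energy_def using h ends energy_weight_le[OF assms(1)]
    by (intro add_mono sum_mono mult_right_mono divide_right_mono) auto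
  also have "\<dots> = \<beta> / \<alpha> * (norm0b N y)\<^sup>2"
  proof -
    have "(\<Sum>i = 1..N - 1. c * (y i)\<^sup>2 * mesh N) + c * (\<alpha>\<^sup>2 + 1) / 2 * (y N)\<^sup>2 * mesh N
        = c * (norm0b N y)\<^sup>2" for c
      unfolding norm0b by (simp add: sum_distrib_left algebra_simps)
    then show ?thesis .
  qed
  finally show "norm1_sq_ge k \<alpha> \<beta> N y \<le> \<beta> / \<alpha> * (norm0b N y)\<^sup>2"
    unfolding norm1_sq_ge_eq_energy[where k = k and \<beta> = \<beta>, OF \<alpha> assms(4)] .
qed

end

section \<open>Maximum principle in time and stability in the first case\<close>

lemma weighted_differences_nonpos_imp_le:
  fixes c E :: "nat \<Rightarrow> real"
  assumes "\<And>s. s \<le> n \<Longrightarrow> 0 \<le> c s" "0 < sum c {..n}"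
    and "(\<Sum>s\<le>n. c s * (e - E s)) \<le> 0" and "\<And>s. s \<le> n \<Longrightarrow> E s \<le> B"
  shows "e \<le> B"
proof -
  \<comment> \<open>The hypothesis says that e is at most a weighted mean of the E_s.\<close>
  have "sum c {..n} * e \<le> (\<Sum>s\<le>n. c s * E s)"
    using assms(3) by (simp add: right_diff_distrib sum_subtractf sum_distrib_right)
  also have "\<dots> \<le> (\<Sum>s\<le>n. c s * B)"
    using assms by (intro sum_mono mult_left_mono) auto
  finally show ?thesis
    using assms(2) by (simp flip: sum_distrib_right)
qed

text \<open>The scheme imposes this only at levels n + 1; at level 0 it comes from the compatibility
  of \<open>u0\<close>.\<close>

lemma scheme_solution_boundary:
  assumes "scheme_solution k u0 \<alpha> \<beta> \<gamma> \<sigma> T N Nt y" "u0 0 = \<alpha> * u0 1" "N \<ge> 1" "n \<le> Nt"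
  shows "y n 0 = \<alpha> * y n N"
proof (cases n)
  case 0
  then show ?thesis
    using assms by (auto simp: scheme_solution_def Let_def node_def mesh_def)
next
  case (Suc m)
  with assms(4) have "m < Nt" by simp
  with assms(1) show ?thesis
    by (auto simp: scheme_solution_def Let_def Suc)
qed

text \<open>The induction is strong because the Caputo derivative remembers all earlier levels: the
  maximum principle takes the bound at every s \<le> m.\<close>

lemma stability_ge:
  assumes \<gamma>: "0 < \<gamma>" "\<gamma> < 1" and \<sigma>: "0 \<le> \<sigma>" "\<sigma> \<le> 1"
    and \<alpha>\<beta>: "\<alpha> * \<beta> > 0" and ge: "\<beta> * inverse \<alpha> \<ge> 1" "\<alpha>\<^sup>2 \<ge> 1"
    and "T > 0" "0 < c1" and k: "\<And>x. x \<in> {0..1} \<Longrightarrow> c1 \<le> k x \<and> k x \<le> c2"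
    and u0: "u0 0 = \<alpha> * u0 1" and N: "N \<ge> 1"
    and sol: "scheme_solution k u0 \<alpha> \<beta> \<gamma> \<sigma> T N Nt y"
    and cond: "\<sigma> \<ge> 1 / (3 - 2 powr (1 - \<gamma>))
                - (mesh N)\<^sup>2 * (2 - 2 powr (1 - \<gamma>))
                  / (2 * c2 * (T / real Nt) powr \<gamma> * (3 - 2 powr (1 - \<gamma>)) * Gamma (2 - \<gamma>))"
  shows "n \<le> Nt \<Longrightarrow> norm1_sq_ge k \<alpha> \<beta> N (y n) \<le> norm1_sq_ge k \<alpha> \<beta> N (y 0)"
proof (induction n rule: less_induct)
  case (less n)
  show ?case
  proof (cases n)
    case 0
    then show ?thesis by simp
  next
    case (Suc m)
    with less.prems have m: "m < Nt" by simp
    define h where "h = mesh N"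
    define \<tau> where "\<tau> = T / real Nt"
    define b where "b = 2 powr (1 - \<gamma>)"
    define d where "d = 1 / (\<tau> powr \<gamma> * Gamma (2 - \<gamma>))"
    define En where "En s = energy k \<alpha> \<beta> N (\<lambda>i. (y s i)\<^sup>2)" for s
    define g where "g = caputo \<gamma> \<tau> y m"
    define w where "w = weighted \<sigma> y m"
    have h: "h > 0" using N by (simp add: h_def mesh_def)
    have \<tau>: "\<tau> > 0" using \<open>T > 0\<close> m by (simp add: \<tau>_def)
    have c2: "c2 > 0" using k[of 0] \<open>0 < c1\<close> by simp
    have \<alpha>: "\<alpha> \<noteq> 0" using \<alpha>\<beta> by auto
    have a: "0 < acoef k N i \<and> acoef k N i \<le> c2" if "i \<in> {1..N}" for i
      using acoef_bounds[of c1 k c2 i N] k that \<open>0 < c1\<close> by force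
    then have a_pos: "0 < acoef k N i" if "i \<in> {1..N}" for i
      using that by simp
    have b: "b < 2"
      using \<gamma> powr_less_mono[of "1 - \<gamma>" 1 "2::real"] by (simp add: b_def)
    have "Gamma (2 - \<gamma>) > 0"
      using \<gamma> by (intro Gamma_real_pos) auto
    then have d: "d > 0" using \<tau> by (simp add: d_def)
    obtain c where c: "\<And>s. s \<le> m \<Longrightarrow> 0 \<le> c s" "sum c {..m} = d" "c m \<ge> (2 - b) * d"
      and caputo: "\<And>y i. caputo \<gamma> \<tau> y m i = (\<Sum>s\<le>m. c s * (y (m + 1) i - y s i))"
      by (rule caputo_weights[OF \<gamma> \<tau>, of m]) (auto simp: b_def d_def)
    have bdry: "y s 0 = \<alpha> * y s N" if "s \<le> Nt" for s
      using scheme_solution_boundary[OF sol u0 N that] .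
    have norm: "norm1_sq_ge k \<alpha> \<beta> N (y s) = En s" if "s \<le> Nt" for s
      unfolding En_def using norm1_sq_ge_eq_energy \<alpha> bdry[OF that] by blast
    have w0: "w 0 = \<alpha> * w N"
      using bdry[of m] bdry[of "m + 1"] m by (simp add: w_def weighted_def algebra_simps)
    \<comment> \<open>The Caputo derivative inherits the nonlocal condition, so \<beta> g_0 + g_N
      becomes (\<alpha>\<beta> + 1) g_N in the boundary equation.\<close>
    have g0: "g 0 = \<alpha> * g N"
      using bdry m by (auto simp: g_def caputo sum_distrib_left algebra_simps intro!: sum.cong)
    define \<kappa> where "\<kappa> = 1/2 * (\<sigma> / d - (1 - \<sigma>) / ((2 - b) * d))"
    have pointwise: "1/2 * (\<Sum>s\<le>m. c s * ((y (Suc m) i)\<^sup>2 - (y s i)\<^sup>2)) + \<kappa> * (g i)\<^sup>2 \<le> g i * w i" for i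
      using weighted_mult_caputo_ge[of m c d "(2 - b) * d" \<sigma> "\<lambda>s. y s i"] c d b \<sigma>
      by (simp add: \<kappa>_def w_def weighted_def g_def caputo mult.commute)
    have "energy k \<alpha> \<beta> N (\<lambda>i. 1/2 * (\<Sum>s\<le>m. c s * ((y (Suc m) i)\<^sup>2 - (y s i)\<^sup>2)) + \<kappa> * (g i)\<^sup>2)
        \<le> energy k \<alpha> \<beta> N (\<lambda>i. g i * w i)"
      using pointwise a by (intro energy_mono N ge \<alpha>\<beta>) auto
    then have "1/2 * (\<Sum>s\<le>m. c s * (En (Suc m) - En s)) + \<kappa> * energy k \<alpha> \<beta> N (\<lambda>i. (g i)\<^sup>2)
        \<le> energy k \<alpha> \<beta> N (\<lambda>i. g i * w i)"
      unfolding energy_add energy_scale energy_sum energy_diff En_def .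
    also have "\<dots> \<le> - (h\<^sup>2 / (4 * c2)) * energy k \<alpha> \<beta> N (\<lambda>i. (g i)\<^sup>2)"
      unfolding energy_def h_def
    proof (rule energy_dissipation[where a = "acoef k N" and \<delta> = "delta1 k \<alpha> \<beta> N"])
      show "g i = diffusion (mesh N) (acoef k N) w i" if "i \<in> {1..N - 1}" for i
        using sol m that by (auto simp: scheme_solution_def Let_def g_def w_def \<tau>_def)
      have "\<beta> * g 0 + g N + 2 / h * (acoef k N N * bdiff h w N - \<beta> * acoef k N 1 * fdiff h w 0) = 0"
        using sol m by (auto simp: scheme_solution_def Let_def g_def w_def \<tau>_def h_def)
      then show "(\<alpha> * \<beta> + 1) * g N + 2 / mesh N * (acoef k N N * bdiff (mesh N) w N
          - \<beta> * acoef k N 1 * fdiff (mesh N) w 0) = 0"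
        by (simp add: g0 h_def algebra_simps)
      show "0 \<le> energy_weight k \<alpha> \<beta> N i" if "i \<le> N" for i
        using energy_weight_ge_1[where i = i, OF N a_pos ge(1)] by simp
      show "energy_weight k \<alpha> \<beta> N N = 1" "energy_weight k \<alpha> \<beta> N 0 = \<beta> / \<alpha>"
        "0 \<le> delta1 k \<alpha> \<beta> N"
        by (rule energy_weight_N energy_weight_0 delta1_nonneg; use N a_pos ge in simp)+
    qed (use N h \<alpha>\<beta> ge a w0 in \<open>auto simp: h_def energy_weight_step[OF N a_pos, simplified]\<close>)
    finally have *: "1/2 * (\<Sum>s\<le>m. c s * (En (Suc m) - En s))
        \<le> - (\<kappa> + h\<^sup>2 / (4 * c2)) * energy k \<alpha> \<beta> N (\<lambda>i. (g i)\<^sup>2)"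
      by (simp add: algebra_simps)
    \<comment> \<open>Multiplying the condition on \<sigma> by 3 - b > 0 gives 2 (2 - b) d times the
      claimed quantity, and b < 2 keeps that factor positive.\<close>
    have "\<kappa> + h\<^sup>2 / (4 * c2) \<ge> 0"
    proof -
      have "1 / (3 - b) - h\<^sup>2 * (2 - b) * d / (2 * c2 * (3 - b)) \<le> \<sigma>"
      proof -
        have "h\<^sup>2 * (2 - b) * d / (2 * c2 * (3 - b)) =
            h\<^sup>2 * (2 - b) / (2 * c2 * \<tau> powr \<gamma> * (3 - b) * Gamma (2 - \<gamma>))"
          by (simp only: d_def times_divide_eq_right mult_1_right divide_divide_eq_left mult_ac)
        then show ?thesis
          using cond by (simp only: b_def h_def \<tau>_def)
      qed
      then have "0 \<le> (3 - b) * (\<sigma> - (1 / (3 - b) - h\<^sup>2 * (2 - b) * d / (2 * c2 * (3 - b))))"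
        using b by simp
      also have "\<dots> = \<sigma> * (3 - b) - 1 + h\<^sup>2 * (2 - b) * d / (2 * c2)"
      proof -
        have "q * (\<sigma> - (1 / q - X / (K * q))) = \<sigma> * q - 1 + X / K" if "q \<noteq> 0" for q K X
          using that by (simp add: right_diff_distrib)
        then show ?thesis using b by simp
      qed
      also have "\<dots> = 2 * (2 - b) * d * (\<kappa> + h\<^sup>2 / (4 * c2))"
        using b c2 d by (simp add: \<kappa>_def divide_simps) (simp add: algebra_simps)
      finally have "0 \<le> 2 * (2 - b) * d * (\<kappa> + h\<^sup>2 / (4 * c2))" .
      moreover have "0 < 2 * (2 - b) * d"
        using b d by simp
      ultimately show ?thesis
        by (meson zero_le_mult_iff not_less)
    qed
    moreover have "0 \<le> energy k \<alpha> \<beta> N (\<lambda>i. (g i)\<^sup>2)"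
    proof -
      have "energy k \<alpha> \<beta> N (\<lambda>i. 0) \<le> energy k \<alpha> \<beta> N (\<lambda>i. (g i)\<^sup>2)"
        using a by (intro energy_mono N ge \<alpha>\<beta>) auto
      then show ?thesis by (simp add: energy_def)
    qed
    ultimately have "(\<kappa> + h\<^sup>2 / (4 * c2)) * energy k \<alpha> \<beta> N (\<lambda>i. (g i)\<^sup>2) \<ge> 0"
      by (rule mult_nonneg_nonneg)
    with * have "(\<Sum>s\<le>m. c s * (En (Suc m) - En s)) \<le> 0"
      by linarith
    then have "En (Suc m) \<le> En 0"
    proof (rule weighted_differences_nonpos_imp_le[rotated 2])
      show "En s \<le> En 0" if "s \<le> m" for s
        using less.IH[of s] that Suc m norm by simp
    qed (use c d in auto)
    then show ?thesis
      using norm Suc m by simp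
  qed
qed

section \<open>Reflection of the interval\<close>

lemma acoef_reflect:
  assumes "i \<le> N" "N \<ge> 1"
  shows "acoef (\<lambda>x. k (1 - x)) N i = acoef k N (Suc (N - i))"
proof -
  \<comment> \<open>The midpoint of the i-th cell is sent to the midpoint of cell N - i + 1.\<close>
  have "1 - (node N i - 0.5 * mesh N) = node N (Suc (N - i)) - 0.5 * mesh N"
    using assms by (simp add: node_def mesh_def of_nat_diff field_simps)
  then show ?thesis by (simp only: acoef_def)
qed

text \<open>Reflection swaps the two ends and reverses the fluxes. Dividing the nonlocal condition
  by \<alpha> (up to sign) and the flux equation by \<beta> restores the form of the scheme.\<close>

lemma scheme_solution_reflect:
  assumes sol: "scheme_solution k u0 \<alpha> \<beta> \<gamma> \<sigma> T N Nt y" and "\<alpha> \<noteq> 0" "\<beta> \<noteq> 0" "N \<ge> 1"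
  shows "scheme_solution (\<lambda>x. k (1 - x)) (\<lambda>x. u0 (1 - x)) (inverse \<alpha>) (inverse \<beta>) \<gamma> \<sigma> T N Nt
    (\<lambda>n i. y n (N - i))"
proof -
  define h where "h = mesh N"
  define \<tau> where "\<tau> = T / real Nt"
  define a where "a = acoef k N"
  define a' where "a' = acoef (\<lambda>x. k (1 - x)) N"
  define y' where "y' = (\<lambda>n i. y n (N - i))"
  have a': "a' i = a (Suc (N - i))" if "i \<le> N" for i
    using that assms by (simp add: a_def a'_def acoef_reflect)
  have cap: "caputo \<gamma> \<tau> y' n i = caputo \<gamma> \<tau> y n (N - i)" for n i
    by (simp add: caputo_def tdiff_def y'_def)
  have wei: "weighted \<sigma> y' n i = weighted \<sigma> y n (N - i)" for n i
    by (simp add: weighted_def y'_def)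
  have "caputo \<gamma> \<tau> y' n i - diffusion h a' (weighted \<sigma> y' n) i = 0"
    if "n < Nt" "i \<in> {1..N - 1}" for n i
  proof -
    have "N - i \<in> {1..N - 1}" using that by auto
    then have "caputo \<gamma> \<tau> y n (N - i) - diffusion h a (weighted \<sigma> y n) (N - i) = 0"
      using sol \<open>n < Nt\<close> by (auto simp: scheme_solution_def Let_def h_def \<tau>_def a_def)
    moreover have "Suc (N - Suc i) = N - i" "N - (i - 1) = Suc (N - i)"
      using that by auto
    then have "diffusion h a' (weighted \<sigma> y' n) i = diffusion h a (weighted \<sigma> y n) (N - i)"
      using that by (simp add: diffusion_def a' wei algebra_simps)
    ultimately show ?thesis by (simp add: cap)
  qed
  moreover have "y' (n + 1) 0 - inverse \<alpha> * y' (n + 1) N = 0" if "n < Nt" for n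
    using sol that \<open>\<alpha> \<noteq> 0\<close> by (auto simp: scheme_solution_def Let_def y'_def)
  moreover have "inverse \<beta> * caputo \<gamma> \<tau> y' n 0 + caputo \<gamma> \<tau> y' n N
      + 2 / h * (a' N * bdiff h (weighted \<sigma> y' n) N
        - inverse \<beta> * a' 1 * fdiff h (weighted \<sigma> y' n) 0) = 0" if "n < Nt" for n
  proof -
    let ?w = "weighted \<sigma> y n"
    have "\<beta> * caputo \<gamma> \<tau> y n 0 + caputo \<gamma> \<tau> y n N
        + 2 / h * (a N * bdiff h ?w N - \<beta> * (a 1 * fdiff h ?w 0)) = 0"
      using sol that by (auto simp: scheme_solution_def Let_def h_def \<tau>_def a_def mult.assoc)
    moreover have "inverse \<beta> * (\<beta> * A + B + 2 / h * (C - \<beta> * D))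
        = inverse \<beta> * B + A + 2 / h * (- D - inverse \<beta> * - C)" for A B C D
      using \<open>\<beta> \<noteq> 0\<close> by (simp add: divide_inverse algebra_simps)
    ultimately have "inverse \<beta> * caputo \<gamma> \<tau> y n N + caputo \<gamma> \<tau> y n 0
        + 2 / h * (- (a 1 * fdiff h ?w 0) - inverse \<beta> * - (a N * bdiff h ?w N)) = 0"
      by (metis mult_zero_right)
    moreover have "a' N * bdiff h (weighted \<sigma> y' n) N = - (a 1 * fdiff h ?w 0)"
      and "a' 1 * fdiff h (weighted \<sigma> y' n) 0 = - (a N * bdiff h ?w N)"
      using \<open>N \<ge> 1\<close> by (simp_all add: a' wei bdiff_def fdiff_def minus_divide_left algebra_simps)
    ultimately show ?thesis
      by (simp only: cap mult.assoc diff_zero diff_self_eq_0)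
  qed
  moreover have "y' 0 i = u0 (1 - node N i)" if "i \<in> {0..N}" for i
  proof -
    have "1 - node N i = node N (N - i)"
      using that \<open>N \<ge> 1\<close> by (simp add: node_def mesh_def of_nat_diff field_simps)
    then show ?thesis
      using sol by (auto simp: scheme_solution_def Let_def y'_def)
  qed
  ultimately show ?thesis
    by (auto simp: scheme_solution_def Let_def y'_def h_def \<tau>_def a'_def)
qed

lemma sum_reflect:
  fixes f :: "nat \<Rightarrow> real"
  shows "(\<Sum>i = 1..N - 1. f (N - i)) = (\<Sum>i = 1..N - 1. f i)"
  by (rule sum.reindex_bij_witness[of _ "\<lambda>i. N - i" "\<lambda>i. N - i"]) auto

lemma p1_reflect:
  assumes "N \<ge> 1"
  shows "p1 (\<lambda>x. k (1 - x)) N i = p1t k N i"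
  using assms by (auto simp: p1_def p1t_def acoef_reflect Suc_diff_Suc intro!: arg_cong[of _ _ sqrt] sum.cong)

text \<open>The end value of the reflected function is y_N = y_0/\<alpha>, which produces the extra
  factor \<open>inverse (\<alpha>\<^sup>2)\<close>; reindexing moves the reflection from y to the
  weight.\<close>

lemma norm1_sq_ge_reflect:
  assumes "N \<ge> 1" "\<alpha> \<noteq> 0" "y 0 = \<alpha> * y N"
  shows "norm1_sq_ge (\<lambda>x. k (1 - x)) (inverse \<alpha>) (inverse \<beta>) N (\<lambda>i. y (N - i))
    = norm1_sq_le k \<alpha> \<beta> N y"
proof -
  have "(norm0 N (\<lambda>i. y (N - i)))\<^sup>2 = (norm0 N y)\<^sup>2"
    unfolding norm0_square by (rule sum_reflect)
  moreover have "(norm0 N (\<lambda>i. p1t k N i * y (N - i)))\<^sup>2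
      = (\<Sum>i = 1..N - 1. (p1t k N (N - i))\<^sup>2 * (y i)\<^sup>2 * mesh N)"
    unfolding norm0_square power_mult_distrib
    by (rule sum.reindex_bij_witness[of _ "\<lambda>i. N - i" "\<lambda>i. N - i"]) auto
  ultimately show ?thesis
    using assms
    by (simp add: norm1_sq_ge_def norm1_sq_le_def delta1_def delta1t_def p1_reflect
        power_mult_distrib power_inverse mult.commute) (simp add: divide_inverse mult_ac)
qed

lemma norm0b_reflect: "norm0b N (\<lambda>i. y (N - i)) = norm0b N y"
  unfolding norm0b_def norm0_square using sum_reflect[of "\<lambda>i. (y i)\<^sup>2 * mesh N" N]
  by (simp add: add.commute)

section \<open>Equivalence constants and the two cases of the theorem\<close>

lemma sqrt_between_multiples:
  assumes "1 \<le> M" "0 \<le> b" "b\<^sup>2 \<le> q" "q \<le> M * b\<^sup>2"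
  shows "1 * b \<le> sqrt q \<and> sqrt q \<le> sqrt M * b"
  using assms real_le_rsqrt[of b q] real_sqrt_le_mono[of q "M * b\<^sup>2"] by (simp add: real_sqrt_mult)

theorem theorem4:
  fixes \<alpha> \<beta> \<gamma> \<sigma> T c1 c2 :: real and k u0 :: "real \<Rightarrow> real"
  assumes "0 < \<gamma>" "\<gamma> < 1" "0 \<le> \<sigma>" "\<sigma> \<le> 1"
    and "\<alpha> * \<beta> > 0"
    and "(\<beta> * inverse \<alpha> - 1) * (\<alpha>\<^sup>2 - 1) \<ge> 0"
    and "T > 0"
    and "0 < c1" "\<And>x. x \<in> {0..1} \<Longrightarrow> c1 \<le> k x \<and> k x \<le> c2"
    and "u0 0 = \<alpha> * u0 1"
  shows "(\<forall>N\<ge>1. \<forall>Nt\<ge>1. \<forall>y.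
            scheme_solution k u0 \<alpha> \<beta> \<gamma> \<sigma> T N Nt y \<longrightarrow>
            \<sigma> \<ge> 1 / (3 - 2 powr (1 - \<gamma>))
                - (mesh N)\<^sup>2 * (2 - 2 powr (1 - \<gamma>))
                  / (2 * c2 * (T / real Nt) powr \<gamma> * (3 - 2 powr (1 - \<gamma>)) * Gamma (2 - \<gamma>)) \<longrightarrow>
            (\<forall>n<Nt. norm1 k \<alpha> \<beta> N (y (n + 1)) \<le> norm1 k \<alpha> \<beta> N (y 0)))
       \<and> (\<exists>m>0. \<exists>M>0. \<forall>N\<ge>1. \<forall>y. y 0 = \<alpha> * y N \<longrightarrow>
            m * norm0b N y \<le> norm1 k \<alpha> \<beta> N y \<and> norm1 k \<alpha> \<beta> N y \<le> M * norm0b N y)"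
proof (cases "\<beta> * inverse \<alpha> - 1 \<ge> 0 \<and> \<alpha>\<^sup>2 - 1 \<ge> 0")
  case True
  note norm = norm1_ge[OF conjunct1[OF True] conjunct2[OF True]]
  have ge: "\<beta> * inverse \<alpha> \<ge> 1" "\<alpha>\<^sup>2 \<ge> 1" using True by auto
  have M: "1 \<le> \<beta> / \<alpha>" using ge by (simp add: divide_inverse)
  show ?thesis
  proof (intro conjI allI impI)
    fix N Nt n y
    assume "1 \<le> N" "scheme_solution k u0 \<alpha> \<beta> \<gamma> \<sigma> T N Nt y" "n < Nt"
      "\<sigma> \<ge> 1 / (3 - 2 powr (1 - \<gamma>))
                - (mesh N)\<^sup>2 * (2 - 2 powr (1 - \<gamma>))
                  / (2 * c2 * (T / real Nt) powr \<gamma> * (3 - 2 powr (1 - \<gamma>)) * Gamma (2 - \<gamma>))"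
    then show "norm1 k \<alpha> \<beta> N (y (n + 1)) \<le> norm1 k \<alpha> \<beta> N (y 0)"
      using stability_ge[where k = k, OF assms(1-5) ge assms(7-10), where n = "n + 1"]
      by (simp add: norm)
  next
    show "\<exists>m>0. \<exists>M>0. \<forall>N\<ge>1. \<forall>y. y 0 = \<alpha> * y N \<longrightarrow>
            m * norm0b N y \<le> norm1 k \<alpha> \<beta> N y \<and> norm1 k \<alpha> \<beta> N y \<le> M * norm0b N y"
    \<comment> \<open>The constants are 1 and the square root of \<beta>/\<alpha>, both independent
      of N.\<close>
    proof (intro exI conjI[rotated] allI impI)
      fix N :: nat and y
      assume "1 \<le> N" "y 0 = \<alpha> * y N"
      moreover have "0 < acoef k N i" if "i \<in> {1..N}" for i
        using acoef_bounds[of c1 k c2 i N] assms(8,9) that by force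
      ultimately have
        "1 * norm0b N y \<le> norm1 k \<alpha> \<beta> N y \<and> norm1 k \<alpha> \<beta> N y \<le> sqrt (\<beta> / \<alpha>) * norm0b N y"
        unfolding norm using norm1_sq_ge_bounds[where N = N and k = k and y = y] ge assms(5) M
        by (intro sqrt_between_multiples) (auto simp: norm0b_def mesh_def)
      then show "norm1 k \<alpha> \<beta> N y \<le> sqrt (\<beta> / \<alpha>) * norm0b N y" "1 * norm0b N y \<le> norm1 k \<alpha> \<beta> N y"
        by auto
    qed (use M in auto)
  qed
next
  case False
  \<comment> \<open>The product of the two factors is nonnegative, so if they are not both
    nonnegative they are both nonpositive.\<close>
  have le: "\<beta> * inverse \<alpha> - 1 \<le> 0" "\<alpha>\<^sup>2 - 1 \<le> 0"
    using False assms(6) by (auto simp: zero_le_mult_iff)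
  note norm = norm1_le[OF le]
  have \<alpha>\<beta>: "\<alpha> \<noteq> 0" "\<beta> \<noteq> 0" "inverse \<alpha> * inverse \<beta> > 0"
    using assms(5) by (auto simp flip: inverse_mult_distrib)
  have ge: "inverse \<beta> * inverse (inverse \<alpha>) \<ge> 1" "(inverse \<alpha>)\<^sup>2 \<ge> 1"
  proof -
    have "0 < \<beta> * inverse \<alpha>"
      using assms(5) by (auto simp: zero_less_mult_iff)
    then have "1 \<le> inverse (\<beta> * inverse \<alpha>)"
      using le by (intro one_le_inverse) auto
    then show "inverse \<beta> * inverse (inverse \<alpha>) \<ge> 1" by simp
    show "(inverse \<alpha>)\<^sup>2 \<ge> 1"
      using le \<alpha>\<beta> by (simp add: power_inverse one_le_inverse)
  qed
  have M: "1 \<le> inverse \<beta> / inverse \<alpha>" using ge by (simp add: divide_inverse)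
  let ?k = "\<lambda>x. k (1 - x)"
  have k: "c1 \<le> ?k x \<and> ?k x \<le> c2" if "x \<in> {0..1}" for x
    using assms(9)[of "1 - x"] that by auto
  have u0: "u0 (1 - 0) = inverse \<alpha> * u0 (1 - 1)"
    using assms(10) \<alpha>\<beta> by simp
  show ?thesis
  proof (intro conjI allI impI)
    fix N Nt n y
    assume N: "1 \<le> N" and sol: "scheme_solution k u0 \<alpha> \<beta> \<gamma> \<sigma> T N Nt y" and n: "n < Nt"
      and cond: "\<sigma> \<ge> 1 / (3 - 2 powr (1 - \<gamma>))
                - (mesh N)\<^sup>2 * (2 - 2 powr (1 - \<gamma>))
                  / (2 * c2 * (T / real Nt) powr \<gamma> * (3 - 2 powr (1 - \<gamma>)) * Gamma (2 - \<gamma>))"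
    \<comment> \<open>The reflected coefficient has the same bounds c1 and c2, so the condition on
      \<sigma> carries over unchanged.\<close>
    have "norm1_sq_ge ?k (inverse \<alpha>) (inverse \<beta>) N (\<lambda>i. y (n + 1) (N - i))
        \<le> norm1_sq_ge ?k (inverse \<alpha>) (inverse \<beta>) N (\<lambda>i. y 0 (N - i))"
      using stability_ge[where k = ?k and n = "n + 1",
          OF assms(1-4) \<alpha>\<beta>(3) ge assms(7,8) k u0 N
          scheme_solution_reflect[OF sol \<alpha>\<beta>(1,2) N] cond] n by simp
    moreover have "norm1_sq_ge ?k (inverse \<alpha>) (inverse \<beta>) N (\<lambda>i. y s (N - i))
        = norm1_sq_le k \<alpha> \<beta> N (y s)" if "s \<le> Nt" for s
      using scheme_solution_boundary[OF sol assms(10) N that]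
      by (intro norm1_sq_ge_reflect N \<alpha>\<beta>(1))
    ultimately show "norm1 k \<alpha> \<beta> N (y (n + 1)) \<le> norm1 k \<alpha> \<beta> N (y 0)"
      using n by (simp add: norm)
  next
    show "\<exists>m>0. \<exists>M>0. \<forall>N\<ge>1. \<forall>y. y 0 = \<alpha> * y N \<longrightarrow>
            m * norm0b N y \<le> norm1 k \<alpha> \<beta> N y \<and> norm1 k \<alpha> \<beta> N y \<le> M * norm0b N y"
    proof (intro exI conjI[rotated] allI impI)
      fix N :: nat and y
      assume N: "1 \<le> N" and y: "y 0 = \<alpha> * y N"
      have "0 < acoef ?k N i" if "i \<in> {1..N}" for i
        using acoef_bounds[of c1 ?k c2 i N] k assms(8) that by force
      then have "1 * norm0b N y \<le> norm1 k \<alpha> \<beta> N y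
          \<and> norm1 k \<alpha> \<beta> N y \<le> sqrt (inverse \<beta> / inverse \<alpha>) * norm0b N y"
        unfolding norm norm1_sq_ge_reflect[OF N \<alpha>\<beta>(1) y, symmetric] norm0b_reflect[of N y, symmetric]
        using norm1_sq_ge_bounds[where N = N and k = ?k and \<beta> = "inverse \<beta>" and \<alpha> = "inverse \<alpha>" and y = "\<lambda>i. y (N - i)"] ge \<alpha>\<beta> M N y
        by (intro sqrt_between_multiples) (auto simp: norm0b_def mesh_def)
      then show "norm1 k \<alpha> \<beta> N y \<le> sqrt (inverse \<beta> / inverse \<alpha>) * norm0b N y"
        "1 * norm0b N y \<le> norm1 k \<alpha> \<beta> N y"
        by auto
    qed (use M in auto)
  qed
qed

end
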